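(* Let $m\ge 1$ and $n\ge 1$ be integers and let $G=K_m\circ\overline{K_n}$ (equivalently, the complete $m$-partite graph $K_{n,n,\ldots,n}$ with $m$ parts of size $n$), a graph on $mn$ vertices. If $n\ge 2$, then $G$ is orientable $\mathbb{Z}_{mn}$-distance magic if and only if $n\not\equiv 1\pmod 2$ or $m\not\equiv 2\pmod 4$. If $n=1$ (so $G=K_m$), then $G$ is orientable $\mathbb{Z}_{m}$-distance magic if and only if $m$ is odd.
   Context: For graphs $G,H$, the lexicographic product $G\circ H$ has vertex set $V(G)\times V(H)$, with $(g,h)$ adjacent to $(g',h')$ iff $g$ is adjacent to $g'$ in $G$, or $g=g'$ and $h$ is adjacent to $h'$ in $H$. $\overline{K_n}$ denotes the edgeless graph on $n$ vertices. For an oriented graph $\vec G$ and a vertex $x$, $N^+(x)$ is the set of vertices $y$ with an arc from $x$ to $y$, and $N^-(x)$ is the set of vertices $y$ with an arc from $y$ to $x$. For an Abelian group $\Gamma$ of order $n$, a directed $\Gamma$-distance magic labeling of an oriented graph $\vec G$ of order $n$ is a bijection $\vec l:V\to\Gamma$ such that there is $\mu\in\Gamma$ with $\sum_{y\in N^+(x)}\vec l(y)-\sum_{y\in N^-(x)}\vec l(y)=\mu$ for every vertex $x$. A simple graph $G$ of order $n$ is orientable $\Gamma$-distance magic if some orientation of its edges admits a directed $\Gamma$-distance magic labeling. $\mathbb{Z}_n$ is the cyclic group of integers modulo $n$. *)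

theory Defs
  imports Main
begin

text \<open>A (finite simple) graph is a pair of a vertex set and a symmetric irreflexive
  edge relation.\<close>
type_synonym 'a graph = "'a set \<times> ('a \<Rightarrow> 'a \<Rightarrow> bool)"

definition verts :: "'a graph \<Rightarrow> 'a set" where "verts G = fst G"
definition adj :: "'a graph \<Rightarrow> 'a \<Rightarrow> 'a \<Rightarrow> bool" where "adj G = snd G"

definition complete_graph :: "nat \<Rightarrow> nat graph" where
  "complete_graph m = ({0..<m}, \<lambda>x y. x \<noteq> y)"

definition edgeless_graph :: "nat \<Rightarrow> nat graph" where
  "edgeless_graph n = ({0..<n}, \<lambda>x y. False)"

definition lex_product :: "'a graph \<Rightarrow> 'b graph \<Rightarrow> ('a \<times> 'b) graph" where
  "lex_product G H = (verts G \<times> verts H,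
     \<lambda>(g,h) (g',h'). adj G g g' \<or> (g = g' \<and> adj H h h'))"

definition is_orientation :: "'a graph \<Rightarrow> ('a \<Rightarrow> 'a \<Rightarrow> bool) \<Rightarrow> bool" where
  "is_orientation G D \<longleftrightarrow>
     (\<forall>x y. D x y \<longrightarrow> x \<in> verts G \<and> y \<in> verts G \<and> adj G x y) \<and>
     (\<forall>x\<in>verts G. \<forall>y\<in>verts G. adj G x y \<longrightarrow> (D x y \<longleftrightarrow> \<not> D y x))"

definition out_nbhd :: "'a graph \<Rightarrow> ('a \<Rightarrow> 'a \<Rightarrow> bool) \<Rightarrow> 'a \<Rightarrow> 'a set" where
  "out_nbhd G D x = {y \<in> verts G. D x y}"

definition in_nbhd :: "'a graph \<Rightarrow> ('a \<Rightarrow> 'a \<Rightarrow> bool) \<Rightarrow> 'a \<Rightarrow> 'a set" where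
  "in_nbhd G D x = {y \<in> verts G. D y x}"

text \<open>Directed Z_k-distance magic labeling of an orientation D of G, where k = |V(G)|.
  Elements of Z_k are represented by the integers 0..k-1; the group operation is addition mod k.\<close>
definition directed_Zn_distance_magic ::
  "'a graph \<Rightarrow> ('a \<Rightarrow> 'a \<Rightarrow> bool) \<Rightarrow> ('a \<Rightarrow> int) \<Rightarrow> bool" where
  "directed_Zn_distance_magic G D l \<longleftrightarrow>
     (let k = int (card (verts G)) in
       bij_betw l (verts G) {0..<k} \<and>
       (\<exists>\<mu>. \<forall>x\<in>verts G.
          ((\<Sum>y\<in>out_nbhd G D x. l y) - (\<Sum>y\<in>in_nbhd G D x. l y)) mod k = \<mu> mod k))"

definition orientable_Zn_distance_magic :: "'a graph \<Rightarrow> bool" where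
  "orientable_Zn_distance_magic G \<longleftrightarrow>
     (\<exists>D l. is_orientation G D \<and> directed_Zn_distance_magic G D l)"

end

theory Submission
  imports Defs
begin

text \<open>
  Let \<open>k = m * n\<close>.

  Necessity: if \<open>k\<close> is even, the weight of a vertex has the parity of the sum of all labels outside
  its part, so all part sums have the same parity. For \<open>m\<close> even this makes the sum of all of
  \<open>0, \<dots>, k - 1\<close> even, which fails for \<open>k mod 4 = 2\<close>; for \<open>n = 1\<close> it makes all labels congruent mod 2.

  Sufficiency, \<open>n\<close> even or \<open>k\<close> odd: take the residue classes mod \<open>m\<close> in \<open>\<int>/k\<close> as parts and orient
  \<open>u \<rightarrow> u + d\<close> for \<open>0 < d < k/2\<close>, \<open>m\<close> not dividing \<open>d\<close>. The only possible conflict \<open>d = k/2\<close> is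
  a multiple of \<open>m\<close>, and every weight is \<open>2 \<Sum>d\<close>.

  Sufficiency, \<open>4\<close> divides \<open>m\<close> and \<open>n \<ge> 3\<close> odd: give each vertex a sign such that every part has
  signed label sum \<open>0\<close>, and let the arcs between parts \<open>i < i'\<close> go from \<open>x\<close> to \<open>y\<close> iff the signs
  of \<open>x\<close> and \<open>y\<close> agree; then all weights vanish. A Skolem sequence of order \<open>m\<close> (pairs \<open>a, a + d\<close> for
  \<open>d = 1, \<dots>, m\<close> that partition \<open>1, \<dots>, 2m\<close>) splits \<open>1, \<dots>, 3m\<close> into triples
  \<open>d, m + a, m + a + d\<close> with signs \<open>+, +, -\<close>. The remaining labels are distributed as
  \<open>q = (n - 3)/2\<close> consecutive pairs per part with signs \<open>+, -\<close>, contributing \<open>-q\<close>; since the signs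
  of a part add up to \<open>1\<close>, shifting all labels by \<open>q\<close> restores signed sum \<open>0\<close>.
\<close>

section \<open>Complete multipartite graphs as lexicographic products\<close>

abbreviation multipartite :: "nat \<Rightarrow> nat \<Rightarrow> (nat \<times> nat) graph" where
  "multipartite m n \<equiv> lex_product (complete_graph m) (edgeless_graph n)"

lemma verts_multipartite: "verts (multipartite m n) = {0..<m} \<times> {0..<n}"
  by (simp add: lex_product_def verts_def complete_graph_def edgeless_graph_def)

lemma adj_multipartite: "adj (multipartite m n) x y \<longleftrightarrow> fst x \<noteq> fst y"
  by (cases x; cases y)
    (simp add: lex_product_def adj_def complete_graph_def edgeless_graph_def)

lemma card_verts_multipartite: "int (card (verts (multipartite m n))) = int m * int n"
  by (simp add: verts_multipartite)

text \<open>Surjectivity comes from counting, so the constructions below only need injectivity and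
  bounds.\<close>

lemma bij_betw_labels:
  fixes l :: "nat \<times> nat \<Rightarrow> int"
  assumes "inj_on l ({0..<m} \<times> {0..<n})"
    and "\<And>x. x \<in> {0..<m} \<times> {0..<n} \<Longrightarrow> 0 \<le> l x \<and> l x < int m * int n"
  shows "bij_betw l ({0..<m} \<times> {0..<n}) {0..<int m * int n}"
proof -
  have "l ` ({0..<m} \<times> {0..<n}) \<subseteq> {0..<int m * int n}"
    using assms(2) by auto
  moreover have "card (l ` ({0..<m} \<times> {0..<n})) = card {0..<int m * int n}"
    using assms(1) by (simp add: card_image nat_mult_distrib)
  ultimately have "l ` ({0..<m} \<times> {0..<n}) = {0..<int m * int n}"
    by (intro card_subset_eq) auto
  then show ?thesis using assms(1) by (simp add: bij_betw_def)
qed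

subsection \<open>Parity obstruction\<close>

text \<open>The sign between out- and in-sums disappears modulo 2, and congruence modulo the even
  number \<open>m * n\<close> implies congruence modulo 2.\<close>

lemma magic_part_sum_parity:
  assumes ori: "is_orientation (multipartite m n) D"
    and magic: "directed_Zn_distance_magic (multipartite m n) D l"
    and ev: "even (m * n)" and "n \<ge> 1"
  obtains \<mu> where "\<And>i. i < m \<Longrightarrow> even ((\<Sum>j<n. l (i, j)) - \<mu>)"
proof -
  define V where "V = {0..<m} \<times> {0..<n}"
  have fin: "finite V" by (simp add: V_def)
  obtain \<mu> where \<mu>: "\<And>x. x \<in> V \<Longrightarrow> ((\<Sum>y\<in>out_nbhd (multipartite m n) D x. l y)
      - (\<Sum>y\<in>in_nbhd (multipartite m n) D x. l y)) mod (int m * int n) = \<mu> mod (int m * int n)"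
    using magic unfolding directed_Zn_distance_magic_def Let_def card_verts_multipartite
    by (auto simp: verts_multipartite V_def)
  \<comment> \<open>The common parity is that of the total label sum minus the magic constant;
    \<open>(i, 0)\<close> serves as the representative of part \<open>i\<close>.\<close>
  have "even ((\<Sum>j<n. l (i, j)) - (sum l V - \<mu>))" if i: "i < m" for i
  proof -
    have x: "(i, 0) \<in> V" using i \<open>n \<ge> 1\<close> by (auto simp: V_def)
    let ?O = "out_nbhd (multipartite m n) D (i, 0)" and ?I = "in_nbhd (multipartite m n) D (i, 0)"
    have arc: "fst y \<noteq> i" if "D (i, 0) y \<or> D y (i, 0)" for y
      using ori that unfolding is_orientation_def adj_multipartite by (metis fst_conv)
    have tour: "D (i, 0) y \<longleftrightarrow> \<not> D y (i, 0)" if "y \<in> V" "fst y \<noteq> i" for y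
      using ori x that
      unfolding is_orientation_def adj_multipartite verts_multipartite V_def[symmetric]
      by (metis fst_conv)
    have mem: "y \<in> V - {i} \<times> {0..<n} \<longleftrightarrow> y \<in> V \<and> fst y \<noteq> i" for y
      by (cases y) (auto simp: V_def)
    have un: "?O \<union> ?I = V - {i} \<times> {0..<n}" and dis: "?O \<inter> ?I = {}"
      unfolding out_nbhd_def in_nbhd_def verts_multipartite V_def[symmetric] set_eq_iff mem
      using arc tour by blast+
    have finOI: "finite ?O" "finite ?I"
      using fin by (auto simp: out_nbhd_def in_nbhd_def verts_multipartite V_def)
    have "sum l ?O + sum l ?I = sum l (V - {i} \<times> {0..<n})"
      using sum.union_disjoint[OF finOI dis, of l] un by simp
    also have "\<dots> = sum l V - sum l ({i} \<times> {0..<n})"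
      using i fin by (intro sum_diff) (auto simp: V_def)
    also have "sum l ({i} \<times> {0..<n}) = (\<Sum>j<n. l (i, j))"
      using sum.cartesian_product[of "\<lambda>i j. l (i, j)" "{0..<n}" "{i}"]
      by (simp add: atLeast0LessThan)
    finally have tot: "sum l ?O + sum l ?I = sum l V - (\<Sum>j<n. l (i, j))" .
    have "int m * int n dvd (sum l ?O - sum l ?I) - \<mu>"
      using \<mu>[OF x] by (simp add: mod_eq_dvd_iff)
    moreover have "even (int m * int n)" using ev by simp
    ultimately have "even ((sum l ?O - sum l ?I) - \<mu>)" using dvd_trans by blast
    with tot show ?thesis by presburger
  qed
  then show ?thesis by (rule that)
qed

text \<open>Summing the congruent part sums over an even number of parts cancels the constant, so
  the sum of all labels would be even.\<close>

lemma not_magic_if_parts_2_mod_4: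
  assumes "odd n" and m: "m mod 4 = 2"
  shows "\<not> orientable_Zn_distance_magic (multipartite m n)"
proof
  assume "orientable_Zn_distance_magic (multipartite m n)"
  then obtain D l where D: "is_orientation (multipartite m n) D"
    and l: "directed_Zn_distance_magic (multipartite m n) D l"
    unfolding orientable_Zn_distance_magic_def by blast
  have "even m" using m by presburger
  have "n \<ge> 1" using \<open>odd n\<close> by (cases n) auto
  obtain \<mu> where \<mu>: "\<And>i. i < m \<Longrightarrow> even ((\<Sum>j<n. l (i, j)) - \<mu>)"
    using magic_part_sum_parity[OF D l _ \<open>n \<ge> 1\<close>] \<open>even m\<close> by auto
  have bij: "bij_betw l ({0..<m} \<times> {0..<n}) {0..<int m * int n}"
    using l unfolding directed_Zn_distance_magic_def Let_def card_verts_multipartite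
    by (simp add: verts_multipartite)
  have "even (\<Sum>i<m. (\<Sum>j<n. l (i, j)) - \<mu>)"
    by (rule dvd_sum) (use \<mu> in auto)
  then have "even ((\<Sum>i<m. \<Sum>j<n. l (i, j)) - int m * \<mu>)"
    by (simp add: sum_subtractf)
  then have "even (\<Sum>i<m. \<Sum>j<n. l (i, j))" using \<open>even m\<close> by simp
  also have "(\<Sum>i<m. \<Sum>j<n. l (i, j)) = sum l ({0..<m} \<times> {0..<n})"
    by (simp add: sum.cartesian_product atLeast0LessThan)
  also have "\<dots> = \<Sum>{0..<int m * int n}"
    using sum.reindex_bij_betw[OF bij, of "\<lambda>x. x"] by simp
  also have "{0..<int m * int n} = int ` {0..<m * n}"
    by (simp add: image_int_atLeastLessThan)
  also have "\<Sum>(int ` {0..<m * n}) = int (\<Sum>{0..<m * n})"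
    by (simp add: sum.reindex)
  finally have ev: "even (\<Sum>{0..<m * n})" by (simp only: even_of_nat)
  obtain a b where a: "m = 4 * a + 2" and b: "n = 2 * b + 1"
    using m \<open>odd n\<close> by (metis mult_div_mod_eq oddE)
  \<comment> \<open>Chosen so that the Gauss sum becomes \<open>(c + 1) * (2 * c + 1)\<close>, a
    product of two odd factors.\<close>
  define c where "c = 4 * a * b + 2 * a + 2 * b"
  have mn: "m * n = 2 * (c + 1)" and "even c" by (auto simp: a b c_def algebra_simps)
  have "\<Sum>{0..<m * n} = (c + 1) * (2 * c + 1)"
    using gauss_sum_nat[of "2 * c + 1"] unfolding mn
    by (simp add: atLeastLessThanSuc_atLeastAtMost algebra_simps)
  with ev \<open>even c\<close> show False by simp
qed

text \<open>Parts are singletons, so all labels would share one parity, yet both 0 and 1 occur as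
  labels.\<close>

lemma complete_not_magic_if_even:
  assumes "even m" "m \<ge> 1"
  shows "\<not> orientable_Zn_distance_magic (multipartite m 1)"
proof
  assume "orientable_Zn_distance_magic (multipartite m 1)"
  then obtain D l where D: "is_orientation (multipartite m 1) D"
    and l: "directed_Zn_distance_magic (multipartite m 1) D l"
    unfolding orientable_Zn_distance_magic_def by blast
  have "m \<ge> 2" using assms by presburger
  obtain \<mu> where \<mu>: "\<And>i. i < m \<Longrightarrow> even (l (i, 0) - \<mu>)"
    using magic_part_sum_parity[OF D l] \<open>even m\<close> by auto
  have "l ` ({0..<m} \<times> {0..<1}) = {0..<int m}"
    using l unfolding directed_Zn_distance_magic_def Let_def card_verts_multipartite
    by (simp add: verts_multipartite bij_betw_def)
  moreover have "0 \<in> {0..<int m}" "1 \<in> {0..<int m}" using \<open>m \<ge> 2\<close> by auto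
  ultimately have "0 \<in> l ` ({0..<m} \<times> {0..<1})" "1 \<in> l ` ({0..<m} \<times> {0..<1})" by simp_all
  then obtain i i' where "i < m" "l (i, 0) = 0" "i' < m" "l (i', 0) = 1" by force
  with \<mu>[of i] \<mu>[of i'] show False by simp
qed

subsection \<open>Circulant orientations\<close>

text \<open>Out- and in-sums are the cases \<open>c = 1\<close> and \<open>c = -1\<close>; the term
  in \<open>u\<close> is common to both and cancels in the weight.\<close>

lemma sum_shift_mod_cong:
  fixes k c :: int
  shows "(\<Sum>d\<in>S. (u + c * d) mod k) mod k = (int (card S) * u + c * \<Sum>S) mod k"
proof -
  have "(\<Sum>d\<in>S. (u + c * d) mod k) mod k = (\<Sum>d\<in>S. u + c * d) mod k"
    by (rule mod_sum_eq)
  then show ?thesis by (simp add: sum.distrib sum_distrib_left)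
qed

text \<open>Adjacency and direction depend only on label differences modulo \<open>k\<close>, so
  every vertex sees the same pattern; \<open>par\<close> excludes a tie at distance
  \<open>k/2\<close>.\<close>

lemma circulant_magic:
  assumes "m \<ge> 1" "n \<ge> 1" and par: "even n \<or> odd (m * n)"
  shows "orientable_Zn_distance_magic (multipartite m n)"
proof -
  define V where "V = {0..<m} \<times> {0..<n}"
  define k where "k = int m * int n"
  define l where "l = (\<lambda>x::nat \<times> nat. int (fst x) + int m * int (snd x))"
  define D where "D = (\<lambda>x y. x \<in> V \<and> y \<in> V \<and> fst x \<noteq> fst y \<and> 2 * ((l y - l x) mod k) < k)"
  define S where "S = {d \<in> {0..<k}. \<not> int m dvd d \<and> 2 * d < k}"
  have k: "k > 0" using assms by (simp add: k_def)
  have mk: "int m dvd k" by (simp add: k_def)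
  have part: "fst x = fst y \<longleftrightarrow> int m dvd l y - l x" if "x \<in> V" "y \<in> V" for x y
  proof -
    have "l y - l x = int (fst y) - int (fst x) + int m * (int (snd y) - int (snd x))"
      by (simp add: l_def algebra_simps)
    then have "int m dvd l y - l x \<longleftrightarrow> int m dvd int (fst y) - int (fst x)"
      by (metis dvd_add_left_iff dvd_triv_left)
    also have "\<dots> \<longleftrightarrow> int (fst y) mod int m = int (fst x) mod int m"
      by (simp add: mod_eq_dvd_iff)
    also have "\<dots> \<longleftrightarrow> fst x = fst y" using that by (auto simp: V_def)
    finally show ?thesis by simp
  qed
  have bij: "bij_betw l V {0..<k}"
    unfolding V_def k_def
  proof (rule bij_betw_labels)
    show "inj_on l ({0..<m} \<times> {0..<n})"
    proof (rule inj_onI)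
      fix x y assume xy: "x \<in> {0..<m} \<times> {0..<n}" "y \<in> {0..<m} \<times> {0..<n}" "l x = l y"
      then have "fst x = fst y" using part[of x y] by (simp add: V_def)
      with xy \<open>m \<ge> 1\<close> show "x = y" by (auto simp: l_def prod_eq_iff)
    qed
    fix x assume x: "x \<in> {0..<m} \<times> {0..<n}"
    then have "int m * (int (snd x) + 1) \<le> int m * int n"
      by (intro mult_left_mono) auto
    with x show "0 \<le> l x \<and> l x < int m * int n" by (auto simp: l_def algebra_simps)
  qed
  \<comment> \<open>An antipodal difference exists only for even \<open>k\<close>; then
    \<open>par\<close> makes \<open>n\<close> even, so both ends lie in one part and no edge needs a
    direction.\<close>
  have half: "int m dvd d" if "2 * d = k" for d
  proof -
    have "even (int (m * n))" using that by (metis dvd_triv_left k_def of_nat_mult)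
    then have "even (m * n)" by (simp only: even_of_nat)
    with par have "even n" by blast
    then obtain b where "n = 2 * b" by blast
    then have "d = int m * int b" using that by (simp add: k_def)
    then show ?thesis by simp
  qed
  have orient: "2 * ((l y - l x) mod k) < k \<longleftrightarrow> \<not> 2 * ((l x - l y) mod k) < k"
    if "x \<in> V" "y \<in> V" "fst x \<noteq> fst y" for x y
  proof -
    have nd: "\<not> int m dvd l y - l x" using part that by blast
    then have "\<not> k dvd l y - l x" using mk dvd_trans by blast
    then have nz: "(l y - l x) mod k \<noteq> 0" by (simp add: dvd_eq_mod_eq_0)
    then have neg: "(l x - l y) mod k = k - (l y - l x) mod k"
      using zmod_zminus1_eq_if[of "l y - l x" k] by (simp only: minus_diff_eq if_False)
    have "int m dvd (l y - l x) mod k \<longleftrightarrow> int m dvd l y - l x"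
      using mk by (simp add: dvd_mod_iff)
    with nd half have "2 * ((l y - l x) mod k) \<noteq> k" by blast
    with neg show ?thesis by linarith
  qed
  have ori: "is_orientation (multipartite m n) D"
    unfolding is_orientation_def adj_multipartite verts_multipartite V_def[symmetric]
    using orient unfolding D_def by metis
  \<comment> \<open>The sign \<open>c\<close> treats out-neighbours (\<open>c = 1\<close>) and
    in-neighbours (\<open>c = -1\<close>) at once. As \<open>c * c = 1\<close>, the inverse map
    sends \<open>d\<close> to the vertex labelled \<open>(l x + c * d) mod k\<close>.\<close>
  have nbhd: "(\<Sum>y | y \<in> V \<and> fst x \<noteq> fst y \<and> 2 * ((c * (l y - l x)) mod k) < k. l y)
      = (\<Sum>d\<in>S. (l x + c * d) mod k)" (is "sum l ?N = _")
    if x: "x \<in> V" and c: "c = 1 \<or> c = -1" for x c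
  proof -
    have cc: "c * c = 1" using c by auto
    have shift: "(l x + c * ((c * (v - l x)) mod k)) mod k = v mod k" for v
    proof -
      have "(l x + c * ((c * (v - l x)) mod k)) mod k = (l x + c * (c * (v - l x))) mod k"
        by (metis mod_add_right_eq mod_mult_right_eq)
      also have "c * (c * (v - l x)) = v - l x" using cc by (simp add: mult.assoc[symmetric])
      finally show ?thesis by simp
    qed
    have "bij_betw (\<lambda>y. (c * (l y - l x)) mod k) ?N S"
    proof (rule bij_betw_byWitness[where f' = "\<lambda>d. the_inv_into V l ((l x + c * d) mod k)"])
      have lV: "l y \<in> {0..<k}" if "y \<in> V" for y using bij that by (auto simp: bij_betw_def)
      have inv: "the_inv_into V l v \<in> V" "l (the_inv_into V l v) = v" if "v \<in> {0..<k}" for v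
        using bij that the_inv_into_into[of l V v V] f_the_inv_into_f_bij_betw[OF bij, of v]
        by (auto simp: bij_betw_def)
      have in_range: "v mod k \<in> {0..<k}" for v using k by simp
      have unshift: "(c * ((l x + c * d) mod k - l x)) mod k = d mod k" for d
      proof -
        have "(c * ((l x + c * d) mod k - l x)) mod k = (c * (l x + c * d - l x)) mod k"
          by (metis mod_diff_left_eq mod_mult_right_eq)
        also have "c * (l x + c * d - l x) = d" using cc by (simp add: mult.assoc[symmetric])
        finally show ?thesis .
      qed
      have dv: "int m dvd (c * v) mod k \<longleftrightarrow> int m dvd v" for v
        using mk c by (auto simp: dvd_mod_iff)
      show "\<forall>y\<in>?N. the_inv_into V l ((l x + c * ((c * (l y - l x)) mod k)) mod k) = y"
        using lV bij by (auto simp: shift the_inv_into_f_f bij_betw_def)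
      show "\<forall>d\<in>S. (c * (l (the_inv_into V l ((l x + c * d) mod k)) - l x)) mod k = d"
        by (auto simp: inv(2)[OF in_range] unshift S_def)
      show "(\<lambda>y. (c * (l y - l x)) mod k) ` ?N \<subseteq> S"
        using k part[OF x] by (auto simp: S_def dv)
      show "(\<lambda>d. the_inv_into V l ((l x + c * d) mod k)) ` S \<subseteq> ?N"
      proof (rule image_subsetI)
        fix d assume d: "d \<in> S"
        let ?v = "(l x + c * d) mod k"
        have "\<not> int m dvd ?v - l x"
          using unshift[of d] dv[of "?v - l x"] d by (auto simp: S_def)
        then have "fst x \<noteq> fst (the_inv_into V l ?v)"
          using part[OF x inv(1)[OF in_range]] inv(2)[OF in_range] by simp
        then show "the_inv_into V l ?v \<in> ?N"
          using d inv[OF in_range] unshift[of d] by (auto simp: S_def)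
      qed
    qed
    then have "(\<Sum>d\<in>S. (l x + c * d) mod k)
        = (\<Sum>y\<in>?N. (l x + c * ((c * (l y - l x)) mod k)) mod k)"
      by (rule sum.reindex_bij_betw[symmetric])
    also have "\<dots> = sum l ?N"
    proof (rule sum.cong)
      fix y assume "y \<in> ?N"
      then have "l y \<in> {0..<k}" using bij by (auto simp: bij_betw_def)
      then show "(l x + c * ((c * (l y - l x)) mod k)) mod k = l y" by (simp add: shift)
    qed simp
    finally show ?thesis by simp
  qed
  have weight: "((\<Sum>y\<in>out_nbhd (multipartite m n) D x. l y)
      - (\<Sum>y\<in>in_nbhd (multipartite m n) D x. l y)) mod k = (2 * \<Sum>S) mod k"
    if x: "x \<in> V" for x
  proof -
    have "out_nbhd (multipartite m n) D x
        = {y. y \<in> V \<and> fst x \<noteq> fst y \<and> 2 * ((1 * (l y - l x)) mod k) < k}"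
      using x by (auto simp: out_nbhd_def verts_multipartite D_def V_def)
    then have out: "(\<Sum>y\<in>out_nbhd (multipartite m n) D x. l y) = (\<Sum>d\<in>S. (l x + 1 * d) mod k)"
      using nbhd[OF x, of 1] by simp
    have "in_nbhd (multipartite m n) D x
        = {y. y \<in> V \<and> fst x \<noteq> fst y \<and> 2 * ((-1 * (l y - l x)) mod k) < k}"
      using x by (auto simp: in_nbhd_def verts_multipartite D_def V_def)
    then have inn: "(\<Sum>y\<in>in_nbhd (multipartite m n) D x. l y) = (\<Sum>d\<in>S. (l x + -1 * d) mod k)"
      using nbhd[OF x, of "-1"] by simp
    have "((\<Sum>d\<in>S. (l x + 1 * d) mod k) - (\<Sum>d\<in>S. (l x + -1 * d) mod k)) mod k
      = ((int (card S) * l x + 1 * \<Sum>S) - (int (card S) * l x + -1 * \<Sum>S)) mod k"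
      by (rule mod_diff_cong) (rule sum_shift_mod_cong)+
    then show ?thesis unfolding out inn by simp
  qed
  have "directed_Zn_distance_magic (multipartite m n) D l"
    unfolding directed_Zn_distance_magic_def Let_def card_verts_multipartite
    unfolding k_def[symmetric] verts_multipartite V_def[symmetric]
    using bij weight by blast
  with ori show ?thesis unfolding orientable_Zn_distance_magic_def by blast
qed

subsection \<open>Signed partitions\<close>

text \<open>Up to a factor depending only on \<open>x\<close> and the part of \<open>y\<close>, the
  vertex \<open>y\<close> contributes \<open>\<epsilon> y * l y\<close> to the weight of
  \<open>x\<close>. Weights are thus combinations of signed part sums, and the magic constant is
  0.\<close>

lemma signed_partition_magic:
  fixes \<epsilon> :: "nat \<times> nat \<Rightarrow> int"
  assumes bij: "bij_betw l ({0..<m} \<times> {0..<n}) {0..<int m * int n}"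
    and sgn: "\<And>x. \<epsilon> x = 1 \<or> \<epsilon> x = -1"
    and zero: "\<And>i. i < m \<Longrightarrow> int m * int n dvd (\<Sum>j<n. \<epsilon> (i, j) * l (i, j))"
  shows "orientable_Zn_distance_magic (multipartite m n)"
proof -
  define V where "V = {0..<m} \<times> {0..<n}"
  define k where "k = int m * int n"
  define D where "D = (\<lambda>x y. x \<in> V \<and> y \<in> V \<and> fst x \<noteq> fst y \<and> (fst x < fst y \<longleftrightarrow> \<epsilon> x = \<epsilon> y))"
  have ori: "is_orientation (multipartite m n) D"
    unfolding is_orientation_def adj_multipartite verts_multipartite V_def[symmetric]
    by (auto simp: D_def)
  have weight: "k dvd (\<Sum>y\<in>out_nbhd (multipartite m n) D x. l y)
      - (\<Sum>y\<in>in_nbhd (multipartite m n) D x. l y)" if x: "x \<in> V" for x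
  proof -
    define \<tau> where "\<tau> = (\<lambda>i. if i = fst x then 0 else if fst x < i then \<epsilon> x else - \<epsilon> x)"
    have fin: "finite V" by (simp add: V_def)
    have "(\<Sum>y\<in>out_nbhd (multipartite m n) D x. l y) - (\<Sum>y\<in>in_nbhd (multipartite m n) D x. l y)
      = (\<Sum>y\<in>V. if D x y then l y else 0) - (\<Sum>y\<in>V. if D y x then l y else 0)"
      using fin by (simp add: out_nbhd_def in_nbhd_def verts_multipartite V_def
          sum.inter_filter[symmetric])
    also have "\<dots> = (\<Sum>y\<in>V. (if D x y then l y else 0) - (if D y x then l y else 0))"
      by (simp add: sum_subtractf)
    also have "\<dots> = (\<Sum>y\<in>V. \<tau> (fst y) * (\<epsilon> y * l y))"
    proof (rule sum.cong)
      fix y assume "y \<in> V"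
      with x show "(if D x y then l y else 0) - (if D y x then l y else 0) = \<tau> (fst y) * (\<epsilon> y * l y)"
        using sgn[of x] sgn[of y] by (auto simp: D_def \<tau>_def)
    qed simp
    also have "\<dots> = (\<Sum>i<m. \<tau> i * (\<Sum>j<n. \<epsilon> (i, j) * l (i, j)))"
      by (simp add: V_def sum.cartesian_product sum_distrib_left atLeast0LessThan case_prod_unfold)
    finally have eq: "(\<Sum>y\<in>out_nbhd (multipartite m n) D x. l y)
        - (\<Sum>y\<in>in_nbhd (multipartite m n) D x. l y) = \<dots>" .
    show ?thesis unfolding eq k_def
      by (intro dvd_sum dvd_mult zero) simp
  qed
  have "directed_Zn_distance_magic (multipartite m n) D l"
    unfolding directed_Zn_distance_magic_def Let_def card_verts_multipartite
      k_def[symmetric] verts_multipartite V_def[symmetric]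
    using bij weight by (auto simp: k_def V_def intro!: exI[of _ 0])
  with ori show ?thesis unfolding orientable_Zn_distance_magic_def by blast
qed

section \<open>Skolem sequences and the labels built from them\<close>

text \<open>
  The smaller position of the pair with difference \<open>d\<close> in Skolem's classical sequence of order \<open>4 s\<close>.
  For \<open>s = 1\<close> the order of the tests matters: \<open>d = 1\<close> must precede \<open>d = 2 * s - 1\<close>.
\<close>
definition skolem :: "int \<Rightarrow> int \<Rightarrow> int" where
  "skolem s d =
     (if even d then 6 * s - d div 2
      else if d = 4 * s - 1 then 2 * s + 1
      else if d = 1 then s
      else if d = 2 * s - 1 then 2 * s
      else if d < 2 * s then 2 * s - d div 2
      else 2 * s - 1 - d div 2)"

text \<open>Removes \<open>div\<close> and parity tests, so that the facts about
  \<open>skolem\<close> become linear arithmetic over pairs of cases.\<close>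

lemma skolem_cases:
  assumes "1 \<le> d" "d \<le> 4 * s"
  obtains e where "d = 2 * e" "1 \<le> e" "e \<le> 2 * s" "skolem s d = 6 * s - e"
  | "d = 4 * s - 1" "s \<ge> 1" "skolem s d = 2 * s + 1"
  | "s \<ge> 1" "d = 1" "skolem s d = s"
  | "s \<ge> 2" "d = 2 * s - 1" "skolem s d = 2 * s"
  | e where "d = 2 * e + 1" "1 \<le> e" "e \<le> s - 2" "skolem s d = 2 * s - e"
  | e where "d = 2 * e + 1" "s \<le> e" "e \<le> 2 * s - 2" "skolem s d = 2 * s - 1 - e"
proof (cases "even d")
  case True
  then obtain e where "d = 2 * e" by blast
  then show ?thesis using that(1)[of e] assms by (simp add: skolem_def)
next
  case False
  then obtain e where e: "d = 2 * e + 1" by (elim oddE)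
  consider "d = 4 * s - 1" | "d \<noteq> 4 * s - 1" "d = 1"
    | "d \<noteq> 4 * s - 1" "d \<noteq> 1" "d = 2 * s - 1"
    | "d \<noteq> 4 * s - 1" "d \<noteq> 1" "d \<noteq> 2 * s - 1" "d < 2 * s"
    | "d \<noteq> 4 * s - 1" "d \<noteq> 1" "d \<noteq> 2 * s - 1" "\<not> d < 2 * s" by blast
  then show ?thesis
  proof cases
    case 1
    show ?thesis by (rule that(2)) (use 1 assms in \<open>auto simp: skolem_def\<close>)
  next
    case 2
    show ?thesis by (rule that(3)) (use 2 assms in \<open>auto simp: skolem_def\<close>)
  next
    case 3
    show ?thesis by (rule that(4)) (use 3 assms in \<open>auto simp: skolem_def\<close>)
  next
    case 4
    show ?thesis by (rule that(5)[of e]) (use 4 assms e in \<open>auto simp: skolem_def\<close>)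
  next
    case 5
    show ?thesis by (rule that(6)[of e]) (use 5 assms e in \<open>simp_all add: skolem_def, presburger+\<close>)
  qed
qed

lemma skolem_bounds:
  assumes "1 \<le> d" "d \<le> 4 * s"
  shows "1 \<le> skolem s d" "skolem s d + d \<le> 8 * s"
  by (rule skolem_cases[OF assms]; linarith)+

text \<open>With the next two lemmas, all \<open>8 * s\<close> endpoints of the pairs are
  distinct.\<close>

lemma skolem_left_inj:
  assumes "1 \<le> d" "d \<le> 4 * s" "1 \<le> d'" "d' \<le> 4 * s" "skolem s d = skolem s d'"
  shows "d = d'"
  by (rule skolem_cases[OF assms(1,2)]; rule skolem_cases[OF assms(3,4)];
      insert assms(5); presburger)

lemma skolem_right_inj:
  assumes "1 \<le> d" "d \<le> 4 * s" "1 \<le> d'" "d' \<le> 4 * s" "skolem s d + d = skolem s d' + d'"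
  shows "d = d'"
  by (rule skolem_cases[OF assms(1,2)]; rule skolem_cases[OF assms(3,4)];
      insert assms(5); presburger)

lemma skolem_left_neq_right:
  assumes "1 \<le> d" "d \<le> 4 * s" "1 \<le> d'" "d' \<le> 4 * s"
  shows "skolem s d \<noteq> skolem s d' + d'"
  by (rule skolem_cases[OF assms(1,2)]; rule skolem_cases[OF assms(3,4)]; presburger)

text \<open>Row \<open>i\<close> is a part. Column 0 uses \<open>1..m\<close>, columns 1 and 2 a
  Skolem pair raised by \<open>m\<close> into \<open>m+1..3m\<close>, and the other columns a block
  of \<open>n - 3\<close> consecutive labels. Labels start at 1, not 0.\<close>

definition skolem_label :: "nat \<Rightarrow> nat \<Rightarrow> nat \<times> nat \<Rightarrow> int" where
  "skolem_label m n x = (case x of (i, j) \<Rightarrow>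
     let d = int i + 1; a = skolem (int m div 4) d in
     if j = 0 then d else if j = 1 then int m + a else if j = 2 then int m + a + d
     else 3 * int m + 1 + int ((n - 3) * i + (j - 3)))"

text \<open>The last four claims separate three zones of labels, so injectivity can be checked zone
  by zone.\<close>

lemma skolem_label_range:
  assumes "4 dvd m" "i < m" "j < n" "n \<ge> 3"
  shows "1 \<le> skolem_label m n (i, j)" "skolem_label m n (i, j) \<le> int m * int n"
    "j = 0 \<Longrightarrow> skolem_label m n (i, j) \<le> int m"
    "j = 1 \<or> j = 2 \<Longrightarrow> int m < skolem_label m n (i, j)"
    "j = 1 \<or> j = 2 \<Longrightarrow> skolem_label m n (i, j) \<le> 3 * int m"
    "j \<ge> 3 \<Longrightarrow> 3 * int m < skolem_label m n (i, j)"
proof -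
  have d: "1 \<le> int i + 1" "int i + 1 \<le> 4 * (int m div 4)"
    using assms by (auto simp flip: of_nat_dvd_iff)
  have m4: "8 * (int m div 4) = 2 * int m" using assms(1) by auto
  note b = skolem_bounds[OF d, unfolded m4]
  show c: "j = 0 \<Longrightarrow> skolem_label m n (i, j) \<le> int m"
    using assms by (simp add: skolem_label_def)
  show "j = 1 \<or> j = 2 \<Longrightarrow> int m < skolem_label m n (i, j)"
    and e: "j = 1 \<or> j = 2 \<Longrightarrow> skolem_label m n (i, j) \<le> 3 * int m"
    using b by (auto simp: skolem_label_def Let_def)
  show "j \<ge> 3 \<Longrightarrow> 3 * int m < skolem_label m n (i, j)"
    by (simp add: skolem_label_def Let_def del: of_nat_add of_nat_mult)
  show "1 \<le> skolem_label m n (i, j)"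
    using b by (simp add: skolem_label_def Let_def del: of_nat_add of_nat_mult)
  consider "j = 0" | "j = 1 \<or> j = 2" | "j \<ge> 3" by linarith
  then show "skolem_label m n (i, j) \<le> int m * int n"
  proof cases
    case 1
    have "int m * 1 \<le> int m * int n" using assms(3) by (intro mult_left_mono) auto
    then show ?thesis using c[OF 1] by simp
  next
    case 2
    have "int m * 3 \<le> int m * int n" using assms(4) by (intro mult_left_mono) auto
    then show ?thesis using e[OF 2] by simp
  next
    case 3
    \<comment> \<open>The block of part \<open>i\<close> ends before offset
      \<open>(n - 3) * (i + 1)\<close>.\<close>
    have "(n - 3) * (i + 1) \<le> (n - 3) * m" using assms(2) by (intro mult_le_mono2) simp
    then have "(n - 3) * i + (j - 3) + 1 \<le> (n - 3) * m" using 3 assms(3) by simp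
    then have "int ((n - 3) * i + (j - 3)) + 1 \<le> int ((n - 3) * m)" by linarith
    also have "\<dots> = int m * int n - 3 * int m" using 3 assms(3)
      by (simp add: of_nat_diff algebra_simps)
    finally show ?thesis using 3 by (simp add: skolem_label_def Let_def)
  qed
qed

lemma block_index_eqD:
  fixes c i j i' j' :: nat
  assumes "c * i + j = c * i' + j'" "j < c" "j' < c"
  shows "i = i'" "j = j'"
proof -
  have "(c * i + j) div c = i" "(c * i' + j') div c = i'" using assms(2,3) by auto
  then show "i = i'" using assms(1) by simp
  then show "j = j'" using assms(1) by simp
qed

lemma inj_on_skolem_label:
  assumes "4 dvd m" "n \<ge> 3"
  shows "inj_on (skolem_label m n) ({0..<m} \<times> {0..<n})"
proof (rule inj_onI)
  fix x y assume "x \<in> {0..<m} \<times> {0..<n}" "y \<in> {0..<m} \<times> {0..<n}"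
    and eq0: "skolem_label m n x = skolem_label m n y"
  then obtain i j i' j' where x: "x = (i, j)" "i < m" "j < n" and y: "y = (i', j')" "i' < m" "j' < n"
    by (cases x; cases y) auto
  note eq = eq0[unfolded x(1) y(1)]
  note rx = skolem_label_range(3-6)[OF assms(1) x(2,3) assms(2)] and ry = skolem_label_range(3-6)[OF assms(1) y(2,3) assms(2)]
  have d: "1 \<le> int i + 1" "int i + 1 \<le> 4 * (int m div 4)"
    "1 \<le> int i' + 1" "int i' + 1 \<le> 4 * (int m div 4)"
    using assms x(2) y(2) by (auto simp flip: of_nat_dvd_iff)
  consider "j = 0" "j' = 0" | "j = 1 \<or> j = 2" "j' = 1 \<or> j' = 2" | "j \<ge> 3" "j' \<ge> 3"
    using rx ry eq by (cases "j = 0"; cases "j \<ge> 3"; cases "j' = 0"; cases "j' \<ge> 3") force+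
  then show "x = y"
  proof cases
    case 1
    then show ?thesis using eq by (simp add: x y skolem_label_def)
  next
    case 2
    then show ?thesis
      using eq skolem_left_inj[OF d] skolem_right_inj[OF d]
        skolem_left_neq_right[OF d] skolem_left_neq_right[OF d(3,4,1,2)]
      by (auto simp: x y skolem_label_def Let_def)
  next
    case 3
    then have "(n - 3) * i + (j - 3) = (n - 3) * i' + (j' - 3)"
      using eq by (simp add: skolem_label_def Let_def del: of_nat_mult of_nat_add)
    moreover have "j - 3 < n - 3" "j' - 3 < n - 3" using 3 x(3) y(3) by auto
    ultimately have "i = i'" "j - 3 = j' - 3" by (rule block_index_eqD)+
    with 3 show ?thesis by (simp add: x y)
  qed
qed

text \<open>The signs are \<open>+ + -\<close> and then \<open>+ -\<close> repeated: the triple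
  contributes \<open>c\<close> and each of the \<open>q\<close> pairs contributes
  \<open>-b\<close>.\<close>

lemma alternating_sum:
  fixes f :: "nat \<Rightarrow> int"
  assumes "f 0 + f 1 = f 2 + c" and "\<And>j. j \<ge> 3 \<Longrightarrow> f (Suc j) = f j + b"
  shows "(\<Sum>j<2 * q + 3. (if j = 0 \<or> odd j then 1 else -1) * f j) = c - int q * b"
proof (induction q)
  case 0
  then show ?case using assms(1) by (simp add: eval_nat_numeral)
next
  case (Suc q)
  have "2 * Suc q + 3 = Suc (Suc (2 * q + 3))" by simp
  then have "(\<Sum>j<2 * Suc q + 3. (if j = 0 \<or> odd j then 1 else -1) * f j)
      = (\<Sum>j<2 * q + 3. (if j = 0 \<or> odd j then 1 else -1) * f j)
        + f (2 * q + 3) - f (Suc (2 * q + 3))"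
    by (simp only: sum.lessThan_Suc) simp
  then show ?case using Suc assms(2)[of "2 * q + 3"] by (simp add: algebra_simps)
qed

lemma skolem_magic:
  assumes "4 dvd m" "odd n" "n \<ge> 3"
  shows "orientable_Zn_distance_magic (multipartite m n)"
proof -
  define k where "k = int m * int n"
  obtain q where q: "n = 2 * q + 3"
  proof
    show "n = 2 * ((n - 3) div 2) + 3" using assms(2,3) by presburger
  qed
  define f where "f = skolem_label m n"
  define l where "l = (\<lambda>x. (f x + int q) mod k)"
  define \<epsilon> where "\<epsilon> = (\<lambda>x::nat \<times> nat. if snd x = 0 \<or> odd (snd x) then 1 else -1 :: int)"
  have range: "1 \<le> f x \<and> f x \<le> k" if "x \<in> {0..<m} \<times> {0..<n}" for x
    using skolem_label_range(1,2)[OF assms(1) _ _ assms(3)] that by (cases x) (auto simp: f_def k_def)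
  have "bij_betw l ({0..<m} \<times> {0..<n}) {0..<int m * int n}"
  proof (rule bij_betw_labels)
    show "inj_on l ({0..<m} \<times> {0..<n})"
    proof (rule inj_onI)
      fix x y assume x: "x \<in> {0..<m} \<times> {0..<n}" and y: "y \<in> {0..<m} \<times> {0..<n}" and "l x = l y"
      then have "k dvd f x - f y" by (simp add: l_def mod_eq_dvd_iff)
      moreover from this have "k dvd f y - f x" by (simp add: dvd_diff_commute)
      \<comment> \<open>Two values in \<open>1..k\<close> differ by less than
        \<open>k\<close>.\<close>
      ultimately have "\<not> 0 < f x - f y" "\<not> 0 < f y - f x"
        using range[OF x] range[OF y] zdvd_imp_le[of k "f x - f y"] zdvd_imp_le[of k "f y - f x"]
        by linarith+
      then have "f x = f y" by simp
      then show "x = y" using inj_on_skolem_label[OF assms(1,3)] x y by (auto simp: f_def dest: inj_onD)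
    qed
    fix x assume x: "x \<in> {0..<m} \<times> {0..<n}"
    then have "k > 0" by (auto simp: k_def)
    then show "0 \<le> l x \<and> l x < int m * int n" by (simp add: l_def flip: k_def)
  qed
  moreover have "\<epsilon> x = 1 \<or> \<epsilon> x = -1" for x by (simp add: \<epsilon>_def)
  moreover have "int m * int n dvd (\<Sum>j<n. \<epsilon> (i, j) * l (i, j))" if "i < m" for i
  proof -
    have "(\<Sum>j<n. \<epsilon> (i, j) * l (i, j)) mod k = (\<Sum>j<n. \<epsilon> (i, j) * (f (i, j) + int q)) mod k"
      by (subst (1 2) mod_sum_eq[symmetric]) (simp add: l_def mod_mult_right_eq)
    \<comment> \<open>For the shifted labels the triple has excess \<open>c = q\<close>, and the
      pairs have step \<open>b = 1\<close>.\<close>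
    also have "(\<Sum>j<n. \<epsilon> (i, j) * (f (i, j) + int q)) = int q - int q * 1"
      unfolding q \<epsilon>_def fst_conv snd_conv
      by (rule alternating_sum) (auto simp: f_def skolem_label_def Let_def Suc_diff_le)
    finally show ?thesis by (simp add: k_def dvd_eq_mod_eq_0)
  qed
  ultimately show ?thesis by (rule signed_partition_magic)
qed

theorem theorem5:
  fixes m n :: nat
  assumes "m \<ge> 1" and "n \<ge> 1"
  shows "(n \<ge> 2 \<longrightarrow>
           (orientable_Zn_distance_magic (lex_product (complete_graph m) (edgeless_graph n))
             \<longleftrightarrow> (n mod 2 \<noteq> 1 \<or> m mod 4 \<noteq> 2)))
       \<and> (n = 1 \<longrightarrow>
           (orientable_Zn_distance_magic (lex_product (complete_graph m) (edgeless_graph n))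
             \<longleftrightarrow> odd m))"
proof (intro conjI impI iffI)
  assume "orientable_Zn_distance_magic (multipartite m n)"
  then show "n mod 2 \<noteq> 1 \<or> m mod 4 \<noteq> 2"
    using not_magic_if_parts_2_mod_4[of n m] by (auto simp: odd_iff_mod_2_eq_one)
next
  assume "n \<ge> 2" "n mod 2 \<noteq> 1 \<or> m mod 4 \<noteq> 2"
  \<comment> \<open>For odd \<open>n\<close> and even \<open>m * n\<close>, \<open>m\<close> is even
    and hence divisible by 4.\<close>
  then have "even n \<or> odd (m * n) \<or> 4 dvd m \<and> odd n \<and> n \<ge> 3"
    unfolding even_mult_iff by presburger
  then show "orientable_Zn_distance_magic (multipartite m n)"
    using circulant_magic[OF assms] skolem_magic by blast
next
  assume "n = 1" "orientable_Zn_distance_magic (multipartite m n)"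
  then show "odd m" using complete_not_magic_if_even[of m] assms by auto
next
  assume "n = 1" "odd m"
  then show "orientable_Zn_distance_magic (multipartite m n)"
    using circulant_magic[OF assms] by simp
qed

end
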